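(* Suppose that $k$ and $s$ are constants and $c=\Theta(n^{-\alpha})$ for some $\alpha\in(0,1)$. Let $\tau$ and $\kappa$ be the largest integers satisfying $\alpha\binom{\tau}{s-1}<1$ and $\alpha\binom{\kappa}{s-1}<s$, respectively, and let $C_t=2n^tc^{\binom{t}{s}}$ for each $s\le t\le k$. Then, on input $G\sim G(n,c,s)$, the algorithm IT-GEN-CLIQUES with the cutoffs $C_t$ outputs $S_k=\mathrm{cl}_k(G)$ with probability $1-n^{-\omega(1)}$, where: (1) the runtime of IT-GEN-CLIQUES is $O\left(n^{\tau+2-\alpha\binom{\tau+1}{s}}\right)$ if $\tau+2\le k\le\kappa+1$; (2) the runtime of IT-GEN-CLIQUES is $O\left(n^{k-\alpha\binom{k-1}{s}}\right)$ if $k<\tau+2$.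
   Context: Here $2\le s\le k$ are integers. $G(n,c,s)$ is the Erdős–Rényi distribution on $s$-uniform hypergraphs with vertex set $[n]$, in which each of the $\binom{n}{s}$ possible hyperedges is included independently with probability $c$. A $t$-clique of $G$ is a $t$-subset $W$ of vertices with $\binom{W}{s}\subseteq E(G)$; $\mathrm{cl}_t(G)$ is the set of $t$-cliques of $G$ (so $\mathrm{cl}_{s-1}(G)$ is the set of all $(s-1)$-subsets of $[n]$). The deterministic algorithm IT-GEN-CLIQUES, on input an $s$-uniform hypergraph on $[n]$, takes in cutoffs $C_t$ and generates sets $S_{s-1},S_s,\dots,S_k$ as follows. (1) Initialize $S_{s-1}$ to be the set of all $(s-1)$-subsets of $[n]$. (2) Given $S_i$, for each vertex $v\in[n]$, iterate through all $A\in S_i$ and add $A\cup\{v\}$ to $S_{i+1}$ if $A\cup\{v\}$ is a clique and $v$ is larger than the labels of all vertices in $A$; stop if ever $|S_{i+1}|\ge C_{i+1}$. (3) Stop once $S_k$ has been generated and output $S_k$. The notation $n^{-\omega(1)}$ denotes a quantity decaying faster than any fixed polynomial in $1/n$.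
   Formalization: The success probability is asserted only in the two listed cases (so k ≤ κ+1); for k > κ+1 it is false, since C_{κ+2}=O(1) and the number of (κ+2)-cliques reaches it with inverse polynomial probability, stopping the algorithm. *)

theory Defs
  imports
    "HOL-Library.Ramsey"
    "HOL-Library.Landau_Symbols"
    "HOL-Probability.Probability"
begin

section \<open>Random hypergraphs and cliques\<close>

text \<open>
  An \<open>s\<close>-uniform hypergraph on \<open>{1..n}\<close> is given by its edge set, a subset of
  \<open>nsets {1..n} s\<close> (the \<open>s\<close>-element subsets of \<open>{1..n}\<close>).
\<close>

definition cliques :: "nat \<Rightarrow> nat \<Rightarrow> nat set set \<Rightarrow> nat \<Rightarrow> nat set set" where
  "cliques n s E t = {W \<in> nsets {1..n} t. nsets W s \<subseteq> E}"

definition random_hypergraph :: "nat \<Rightarrow> real \<Rightarrow> nat \<Rightarrow> nat set set pmf" where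
  "random_hypergraph n c s =
     map_pmf (\<lambda>f. {e \<in> nsets {1..n} s. f e})
       (Pi_pmf (nsets {1..n} s) False (\<lambda>_. bernoulli_pmf c))"


section \<open>Computations with a step count\<close>

text \<open>
  A computation is a pair of its result and the number of elementary steps it takes.
  The elementary steps are those of a unit-cost random access machine: comparing two
  numbers, incrementing a counter, allocating or reading a list cell, one iteration of a loop
  (or one recursive call), and looking up in the input whether a given set is a hyperedge.
\<close>

type_synonym 'a timed = "'a \<times> nat"

definition ret :: "'a \<Rightarrow> 'a timed" where
  "ret x = (x, 0)"

definition charge :: "nat \<Rightarrow> 'a timed \<Rightarrow> 'a timed" where
  "charge m p = (fst p, m + snd p)"

definition andthen :: "'a timed \<Rightarrow> ('a \<Rightarrow> 'b timed) \<Rightarrow> 'b timed" (infixl "\<rhd>" 54) where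
  "p \<rhd> f = charge (snd p) (f (fst p))"


section \<open>The algorithm\<close>

text \<open>
  A set of vertices is represented by the list of its labels in decreasing order, so that
  adding a new largest vertex \<open>v\<close> to \<open>A\<close> is \<open>v # A\<close>. A collection of such sets is a list.
\<close>

fun add_to_all :: "nat \<Rightarrow> nat list list \<Rightarrow> nat list list \<Rightarrow> nat list list timed" where
  "add_to_all v [] Bs = charge 1 (ret Bs)"
| "add_to_all v (A # As) Bs = charge 3 (add_to_all v As ((v # A) # Bs))"

text \<open>All sublists of length \<open>r\<close>.\<close>

fun combinations :: "nat \<Rightarrow> nat list \<Rightarrow> nat list list timed" where
  "combinations 0 vs = charge 1 (ret [[]])"
| "combinations (Suc r) [] = charge 1 (ret [])"
| "combinations (Suc r) (v # vs) = charge 1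
     (combinations r vs \<rhd> (\<lambda>As.
      combinations (Suc r) vs \<rhd> (\<lambda>Bs.
      add_to_all v As Bs)))"

text \<open>The cost of a lookup includes reading off the labels that form the address.\<close>

fun all_edges :: "nat set set \<Rightarrow> nat list list \<Rightarrow> bool timed" where
  "all_edges E [] = charge 1 (ret True)"
| "all_edges E (e # es) = charge (2 + length e)
     (if set e \<in> E then all_edges E es else ret False)"

definition test_clique :: "nat \<Rightarrow> nat set set \<Rightarrow> nat list \<Rightarrow> bool timed" where
  "test_clique s E W = combinations s W \<rhd> all_edges E"

fun test_larger :: "nat \<Rightarrow> nat list \<Rightarrow> bool timed" where
  "test_larger v [] = charge 1 (ret True)"
| "test_larger v (a # A) = charge 2 (if a < v then test_larger v A else ret False)"

text \<open>
  The inner loop: for a fixed \<open>v\<close>, iterate through the sets \<open>A\<close> in \<open>S\<^sub>i\<close>. The pair \<open>(m, T)\<close> is the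
  current \<open>S\<^sub>i\<^sub>+\<^sub>1\<close>, as a list \<open>T\<close> together with its size \<open>m\<close>; every set enters \<open>T\<close> at most once,
  because it determines its largest element \<open>v\<close> and the remainder \<open>A\<close>. The result \<open>None\<close> says that
  the cutoff \<open>C\<close> was reached, upon which the whole algorithm stops without output.
\<close>

fun scan :: "nat \<Rightarrow> nat set set \<Rightarrow> real \<Rightarrow> nat \<Rightarrow> nat list list \<Rightarrow> nat \<times> nat list list
    \<Rightarrow> (nat \<times> nat list list) option timed" where
  "scan s E C v [] (m, T) = charge 2 (if C \<le> real m then ret None else ret (Some (m, T)))"
| "scan s E C v (A # As) (m, T) = charge 2
     (if C \<le> real m then ret None
      else test_larger v A \<rhd> (\<lambda>larger.
           (if larger then test_clique s E (v # A) else ret False) \<rhd> (\<lambda>add.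
           if add then charge 3 (scan s E C v As (m + 1, (v # A) # T))
           else scan s E C v As (m, T))))"

text \<open>The outer loop, through the list of vertices.\<close>

fun sweep :: "nat \<Rightarrow> nat set set \<Rightarrow> real \<Rightarrow> nat list \<Rightarrow> nat list list \<Rightarrow> nat \<times> nat list list
    \<Rightarrow> nat list list option timed" where
  "sweep s E C [] S (m, T) = charge 1 (ret (Some T))"
| "sweep s E C (v # vs) S (m, T) = charge 1
     (scan s E C v S (m, T) \<rhd> (\<lambda>r.
      case r of None \<Rightarrow> ret None | Some st \<Rightarrow> sweep s E C vs S st))"

text \<open>Generate \<open>S\<^sub>i\<^sub>+\<^sub>r\<close> from \<open>S\<^sub>i\<close>.\<close>

fun generate :: "nat \<Rightarrow> nat set set \<Rightarrow> (nat \<Rightarrow> real) \<Rightarrow> nat list \<Rightarrow> nat \<Rightarrow> nat \<Rightarrow> nat list list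
    \<Rightarrow> nat list list option timed" where
  "generate s E C vs 0 i S = charge 1 (ret (Some S))"
| "generate s E C vs (Suc r) i S = charge 1
     (sweep s E (C (i + 1)) vs S (0, []) \<rhd> (\<lambda>res.
      case res of None \<Rightarrow> ret None | Some S' \<Rightarrow> generate s E C vs r (i + 1) S'))"

text \<open>The first charge is for building the two lists of all vertices.\<close>

definition it_gen_cliques ::
    "nat \<Rightarrow> nat \<Rightarrow> nat \<Rightarrow> (nat \<Rightarrow> real) \<Rightarrow> nat set set \<Rightarrow> nat list list option timed" where
  "it_gen_cliques n s k C E = charge (4 * (n + 1))
     (combinations (s - 1) (rev [1..<n + 1]) \<rhd>
      generate s E C [1..<n + 1] (k - (s - 1)) (s - 1))"

text \<open>The output \<open>S\<^sub>k\<close> as a set of vertex sets; \<open>None\<close> if a cutoff was reached.\<close>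

definition clique_output ::
    "nat \<Rightarrow> nat \<Rightarrow> nat \<Rightarrow> (nat \<Rightarrow> real) \<Rightarrow> nat set set \<Rightarrow> nat set set option" where
  "clique_output n s k C E = map_option (\<lambda>S. set ` set S) (fst (it_gen_cliques n s k C E))"

text \<open>The largest number of steps on any \<open>s\<close>-uniform hypergraph on \<open>{1..n}\<close>.\<close>

definition worst_case_runtime :: "nat \<Rightarrow> nat \<Rightarrow> nat \<Rightarrow> (nat \<Rightarrow> real) \<Rightarrow> nat" where
  "worst_case_runtime n s k C = Max ((\<lambda>E. snd (it_gen_cliques n s k C E)) ` Pow (nsets {1..n} s))"


section \<open>Parameters\<close>

definition cutoff :: "nat \<Rightarrow> real \<Rightarrow> nat \<Rightarrow> nat \<Rightarrow> real" where
  "cutoff n c s t = 2 * real n ^ t * c ^ (t choose s)"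

text \<open>The functions that are \<open>n\<close> to the power \<open>-\<omega>(1)\<close>.\<close>

definition superpoly_small :: "(nat \<Rightarrow> real) \<Rightarrow> bool" where
  "superpoly_small f \<longleftrightarrow> (\<forall>d::nat. f \<in> o(\<lambda>n. real n powr (- real d)))"

end

theory Submission
  imports Defs "HOL-Real_Asymp.Real_Asymp"
begin

text \<open>
  If no cutoff is reached, the algorithm lists every clique exactly once, as its decreasing
  list of labels; so it succeeds as soon as \<open>X\<^sub>t = card (cl\<^sub>t(G)) < C\<^sub>t\<close> for all \<open>s \<le> t \<le> k\<close>. For the
  upper tail of \<open>X\<^sub>t\<close> put \<open>N = n\<^sup>t c\<^bsup>(t choose s)\<^esup>\<close> and consider moments of growing order
  \<open>m \<approx> (ln n)\<^sup>2\<close>. Conditioning on \<open>m\<close> given \<open>t\<close>-sets being cliques raises the mean of \<open>X\<^sub>t\<close> to at most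
  \<open>N \<Sum>\<^sub>j (m t)\<^sup>j / (n\<^sup>j c\<^bsup>(j choose s)\<^esup>)\<close>, where \<open>j\<close> is the size of the overlap. The term \<open>j = 0\<close> is 1, and
  the others tend to 0, because \<open>j - \<alpha> (j choose s) = j (1 - \<alpha> ((j-1) choose (s-1)) / s)\<close> is positive
  for \<open>1 \<le> j \<le> \<kappa> + 1\<close>. Hence \<open>E X\<^sub>t\<^sup>m \<le> (3N/2)\<^sup>m\<close>, and Markov's inequality gives
  \<open>P(X\<^sub>t \<ge> 2N) \<le> (3/4)\<^sup>m\<close>, which is \<open>n\<close> to the power \<open>-\<omega>(1)\<close>.

  The cost of generating \<open>S\<^sub>j\<^sub>+\<^sub>1\<close> is of order \<open>n\<close> times the size of \<open>S\<^sub>j\<close>, which the cutoff bounds by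
  order \<open>n\<close> to the power \<open>j - \<alpha> (j choose s)\<close>. The increment of this exponent from \<open>j\<close> to \<open>j + 1\<close> is
  \<open>1 - \<alpha> (j choose (s-1))\<close>, positive exactly for \<open>j \<le> \<tau>\<close>, so the largest exponent with
  \<open>s - 1 \<le> j < k\<close> occurs at \<open>j = min (\<tau> + 1) (k - 1)\<close>.
\<close>

section \<open>The output of the algorithm\<close>

lemmas timed_defs = ret_def charge_def andthen_def

lemma fst_add_to_all: "fst (add_to_all v As Bs) = rev (map ((#) v) As) @ Bs"
  by (induction v As Bs rule: add_to_all.induct) (auto simp: timed_defs)

lemma snd_add_to_all: "snd (add_to_all v As Bs) = 3 * length As + 1"
  by (induction v As Bs rule: add_to_all.induct) (auto simp: timed_defs)

lemma binomial_le_power: "n choose r \<le> n ^ r"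
  by (cases "r \<le> n") (auto intro: binomial_le_pow simp: binomial_eq_0)

section \<open>Decreasing lists as codes of finite vertex sets\<close>

lemma sorted_wrt_greater_imp_distinct: "sorted_wrt (>) (xs :: nat list) \<Longrightarrow> distinct xs"
  by (induction xs) auto

text \<open>The codes of the \<open>r\<close>-subsets of \<open>V\<close>: \<open>set\<close> maps
  these lists bijectively onto \<open>nsets V r\<close>.\<close>

definition desc_lists :: "nat set \<Rightarrow> nat \<Rightarrow> nat list set" where
  "desc_lists V r = {W. sorted_wrt (>) W \<and> set W \<subseteq> V \<and> length W = r}"

lemma length_combinations: "length (fst (combinations r vs)) = length vs choose r"
  by (induction r vs rule: combinations.induct) (auto simp: timed_defs fst_add_to_all)

lemma length_mem_combinations: "us \<in> set (fst (combinations r vs)) \<Longrightarrow> length us = r"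
  by (induction r vs arbitrary: us rule: combinations.induct) (auto simp: timed_defs fst_add_to_all)

lemma desc_lists_0: "desc_lists V 0 = {[]}"
  by (auto simp: desc_lists_def)

lemma desc_lists_empty: "desc_lists {} (Suc r) = {}"
  by (auto simp: desc_lists_def)

text \<open>Pascal's rule for lists, matching the recursion of \<open>combinations\<close>: either
  the maximum \<open>v\<close> is the head, or the head lies below \<open>v\<close> and
  \<open>v\<close> cannot occur further on.\<close>

lemma desc_lists_insert:
  assumes "\<forall>x\<in>V. x < v"
  shows "desc_lists (insert v V) (Suc r) = (#) v ` desc_lists V r \<union> desc_lists V (Suc r)" (is "?l = ?r")
proof
  show "?l \<subseteq> ?r"
  proof
    fix W assume W: "W \<in> ?l"
    then obtain a A where aA: "W = a # A" by (cases W) (auto simp: desc_lists_def)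
    show "W \<in> ?r"
    proof (cases "a = v")
      case True
      then have "A \<in> desc_lists V r" using W aA by (auto simp: desc_lists_def)
      then show ?thesis using True aA by simp
    next
      case False
      then have "a \<in> V" using W aA by (auto simp: desc_lists_def)
      then have "a < v" using assms by blast
      moreover have "\<forall>x\<in>set A. x < a" using W aA by (auto simp: desc_lists_def)
      ultimately have "v \<notin> set A" by auto
      then show ?thesis using W aA False by (auto simp: desc_lists_def)
    qed
  qed
  show "?r \<subseteq> ?l" using assms by (fastforce simp: desc_lists_def)
qed

lemma set_combinations:
  "sorted_wrt (>) vs \<Longrightarrow> set (fst (combinations r vs)) = desc_lists (set vs) r"
proof (induction r vs rule: combinations.induct)
  case (3 r v vs)
  then show ?case
    by (subst list.set, subst desc_lists_insert) (auto simp: timed_defs fst_add_to_all)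
qed (auto simp: timed_defs desc_lists_0 desc_lists_empty)

lemma set_image_desc_lists: "set ` desc_lists V r = nsets V r"
proof
  show "set ` desc_lists V r \<subseteq> nsets V r"
    by (auto simp: desc_lists_def nsets_def distinct_card sorted_wrt_greater_imp_distinct)
  show "nsets V r \<subseteq> set ` desc_lists V r"
  proof
    fix X assume X: "X \<in> nsets V r"
    then have "rev (sorted_list_of_set X) \<in> desc_lists V r" 
      by (auto simp: desc_lists_def nsets_def sorted_wrt_rev)
    moreover have "set (rev (sorted_list_of_set X)) = X"
      using X by (auto simp: nsets_def)
    ultimately show "X \<in> set ` desc_lists V r" by (metis imageI)
  qed
qed

lemma inj_on_set_desc: "inj_on set {W :: nat list. sorted_wrt (>) W}"
proof (rule inj_onI)
  fix x y :: "nat list"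
  assume "x \<in> {W. sorted_wrt (>) W}" "y \<in> {W. sorted_wrt (>) W}" "set x = set y"
  then have "sorted_wrt (<) (rev x)" "sorted_wrt (<) (rev y)" "set (rev x) = set (rev y)"
    by (auto simp: sorted_wrt_rev)
  then have "rev x = rev y" by (metis strict_sorted_equal)
  then show "x = y" by simp
qed

lemma card_desc_lists: "card (desc_lists V r) = card (nsets V r)"
proof -
  have "inj_on set (desc_lists V r)"
    by (rule inj_on_subset[OF inj_on_set_desc]) (auto simp: desc_lists_def)
  then show ?thesis by (metis card_image set_image_desc_lists)
qed

text \<open>By counting: the length and the number of distinct entries are both
  \<open>length vs choose r\<close>.\<close>

lemma distinct_combinations:
  assumes "sorted_wrt (>) vs"
  shows "distinct (fst (combinations r vs))"
proof (rule card_distinct)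
  have "distinct vs"
    using assms by (rule sorted_wrt_greater_imp_distinct)
  then show "card (set (fst (combinations r vs))) = length (fst (combinations r vs))"
    using card_nsets[of "set vs" r]
    by (simp add: set_combinations assms card_desc_lists length_combinations distinct_card)
qed

text \<open>With \<open>n = length vs + 1\<close>, the bound survives Pascal's recursion because
  \<open>n ^ Suc r + n ^ r \<le> (n + 1) ^ Suc r\<close>. The extra 6 per level pays for the
  overhead and \<open>add_to_all\<close>.\<close>

lemma snd_combinations: "snd (combinations r vs) \<le> (6 * r + 1) * (length vs + 1) ^ r"
proof (induction r vs rule: combinations.induct)
  case (3 r v vs)
  let ?n = "length vs + 1"
  have b: "length vs choose r \<le> ?n ^ r"
    by (rule order.trans[OF binomial_le_power power_mono]) auto
  have p: "?n ^ Suc r + ?n ^ r \<le> (?n + 1) ^ Suc r"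
    using mult_left_mono[OF power_mono[of ?n "?n + 1" r], of "?n + 1"] by simp
  have o: "1 \<le> ?n ^ r" by simp
  have "snd (combinations (Suc r) (v # vs)) = 
     2 + snd (combinations r vs) + snd (combinations (Suc r) vs) + 3 * (length vs choose r)"
    by (simp add: timed_defs snd_add_to_all length_combinations)
  also have "\<dots> \<le> 2 * ?n ^ r + (6 * r + 1) * ?n ^ r + (6 * Suc r + 1) * ?n ^ Suc r + 3 * ?n ^ r"
    using 3 b o by (intro add_mono) auto
  also have "\<dots> \<le> (6 * Suc r + 1) * (?n ^ Suc r + ?n ^ r)"
    by (simp add: algebra_simps)
  also have "\<dots> \<le> (6 * Suc r + 1) * (?n + 1) ^ Suc r"
    using p by (rule mult_left_mono) auto
  finally show ?case by simp
qed (auto simp: timed_defs)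

lemma fst_all_edges: "fst (all_edges E es) \<longleftrightarrow> set ` set es \<subseteq> E"
  by (induction E es rule: all_edges.induct) (auto simp: timed_defs)

lemma snd_all_edges: "(\<And>e. e \<in> set es \<Longrightarrow> length e = s) \<Longrightarrow> snd (all_edges E es) \<le> length es * (s + 2) + 1"
proof (induction E es rule: all_edges.induct)
  case (2 E e es)
  then show ?case by (cases "set e \<in> E") (auto simp: timed_defs)
qed (auto simp: timed_defs)

lemma fst_test_clique:
  "sorted_wrt (>) W \<Longrightarrow> fst (test_clique s E W) \<longleftrightarrow> nsets (set W) s \<subseteq> E"
  by (simp add: test_clique_def timed_defs fst_all_edges set_combinations set_image_desc_lists)

lemma snd_test_clique: "snd (test_clique s E W) \<le> (8 * s + 4) * (length W + 1) ^ s"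
proof -
  have b: "length W choose s \<le> (length W + 1) ^ s"
    by (rule order.trans[OF binomial_le_power power_mono]) auto
  have "snd (test_clique s E W) \<le> (6 * s + 1) * (length W + 1) ^ s + ((length W choose s) * (s + 2) + 1)"
    unfolding test_clique_def timed_defs
    using add_mono[OF snd_combinations[of s W]
        snd_all_edges[of "fst (combinations s W)" s E, OF length_mem_combinations]]
    by (simp add: length_combinations)
  also have "\<dots> \<le> (6 * s + 1) * (length W + 1) ^ s + ((length W + 1) ^ s * (s + 2) + (length W + 1) ^ s)"
    using b by (intro add_mono mult_right_mono) auto
  also have "\<dots> \<le> (8 * s + 4) * (length W + 1) ^ s" by (simp add: algebra_simps)
  finally show ?thesis .
qed

lemma fst_test_larger: "fst (test_larger v A) \<longleftrightarrow> (\<forall>a\<in>set A. a < v)"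
  by (induction v A rule: test_larger.induct) (auto simp: timed_defs)

lemma snd_test_larger: "snd (test_larger v A) \<le> 2 * length A + 1"
  by (induction v A rule: test_larger.induct) (auto simp: timed_defs)

section \<open>Correctness of the successive levels\<close>

definition extensions :: "nat \<Rightarrow> nat set set \<Rightarrow> nat list list \<Rightarrow> nat \<Rightarrow> nat list list" where
  "extensions s E S v = map ((#) v) (filter (\<lambda>A. (\<forall>a\<in>set A. a < v) \<and> fst (test_clique s E (v # A))) S)"

text \<open>The counter never decreases, so a final size below \<open>C\<close> means that every
  earlier comparison passed. New lists go to the front, whence the \<open>rev\<close>.\<close>

lemma fst_scan:
  "real (m + length (extensions s E S v)) < C \<Longrightarrow>
    fst (scan s E C v S (m, T)) = Some (m + length (extensions s E S v), rev (extensions s E S v) @ T)"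
proof (induction S arbitrary: m T)
  case (Cons A S)
  show ?case
  proof (cases "fst (test_larger v A)")
    case True
    then show ?thesis using Cons by (auto simp: timed_defs extensions_def fst_test_larger)
  next
    case False
    then have "extensions s E (A # S) v = extensions s E S v"
      by (auto simp: extensions_def fst_test_larger)
    then show ?thesis using Cons False by (simp add: timed_defs)
  qed
qed (simp add: timed_defs extensions_def)

lemma fst_sweep:
  "real (m + length (concat (map (extensions s E S) vs))) < C \<Longrightarrow>
    fst (sweep s E C vs S (m, T)) = Some (rev (concat (map (extensions s E S) vs)) @ T)"
  by (induction vs arbitrary: m T) (auto simp: timed_defs fst_scan add.assoc)

definition clique_lists :: "nat \<Rightarrow> nat \<Rightarrow> nat set set \<Rightarrow> nat \<Rightarrow> nat list set" where
  "clique_lists n s E i = {W \<in> desc_lists {1..n} i. nsets (set W) s \<subseteq> E}"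

lemma set_image_clique_lists: "set ` clique_lists n s E i = cliques n s E i"
  unfolding clique_lists_def cliques_def set_image_desc_lists[symmetric] by auto

lemma card_clique_lists: "card (clique_lists n s E i) = card (cliques n s E i)"
proof -
  have "inj_on set (clique_lists n s E i)"
    by (rule inj_on_subset[OF inj_on_set_desc]) (auto simp: desc_lists_def clique_lists_def)
  then show ?thesis by (metis card_image set_image_clique_lists)
qed

text \<open>Deleting the largest vertex of a clique leaves a clique, so each clique of size
  \<open>Suc i\<close> is found from a member of \<open>S\<close> when the sweep reaches its
  maximum.\<close>

lemma set_extensions:
  assumes "set S = clique_lists n s E i"
  shows "set (concat (map (extensions s E S) [1..<n + 1])) = clique_lists n s E (Suc i)" (is "?l = ?r")
proof
  have e: "set (extensions s E S v) = {v # A | A. A \<in> clique_lists n s E i \<and> (\<forall>a\<in>set A. a < v)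
     \<and> nsets (insert v (set A)) s \<subseteq> E}" for v
    using assms by (auto simp: extensions_def fst_test_clique clique_lists_def desc_lists_def)
  show "?l \<subseteq> ?r"
    by (fastforce simp: e clique_lists_def desc_lists_def)
  show "?r \<subseteq> ?l"
  proof
    fix W assume W: "W \<in> ?r"
    then obtain v A where vA: "W = v # A" by (cases W) (auto simp: clique_lists_def desc_lists_def)
    have "nsets (set A) s \<subseteq> nsets (set W) s" by (rule nsets_mono) (auto simp: vA)
    then have "A \<in> clique_lists n s E i" "\<forall>a\<in>set A. a < v" "v \<in> {1..n}" "nsets (insert v (set A)) s \<subseteq> E"
      using W vA by (auto simp: clique_lists_def desc_lists_def)
    then show "W \<in> ?l" using vA by (auto simp: e)
  qed
qed

lemma distinct_extensions:
  assumes "distinct S" "distinct vs"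
  shows "distinct (concat (map (extensions s E S) vs))"
  using assms(2)
proof (induction vs)
  case (Cons v vs)
  have "distinct (extensions s E S v)" using assms(1)
    by (auto simp: extensions_def distinct_map)
  then show ?case using Cons by (auto simp: extensions_def)
qed auto

text \<open>Distinctness is carried along because list lengths are compared with the cutoffs:
  without repetitions the length is the number of cliques.\<close>

lemma fst_generate:
  assumes "distinct S" "set S = clique_lists n s E i"
    and "\<And>j. i < j \<Longrightarrow> j \<le> i + r \<Longrightarrow> real (card (cliques n s E j)) < C j"
  shows "\<exists>S'. fst (generate s E C [1..<n + 1] r i S) = Some S' \<and> set S' = clique_lists n s E (i + r)"
  using assms
proof (induction r arbitrary: i S)
  case 0
  then show ?case by (simp add: timed_defs)
next
  case (Suc r)
  define S' where "S' = rev (concat (map (extensions s E S) [1..<n + 1]))"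
  have d: "distinct S'" unfolding S'_def distinct_rev
    by (rule distinct_extensions[OF Suc.prems(1)]) simp
  have s: "set S' = clique_lists n s E (Suc i)" unfolding S'_def set_rev
    by (rule set_extensions[OF Suc.prems(2)])
  have l: "length S' = card (cliques n s E (Suc i))"
    using distinct_card[OF d] s card_clique_lists by simp
  have "real (0 + length (concat (map (extensions s E S) [1..<n + 1]))) < C (Suc i)"
    using l Suc.prems(3)[of "Suc i"] by (simp add: S'_def del: upt_Suc)
  from fst_sweep[OF this, of "[]"]
  have "fst (sweep s E (C (Suc i)) [1..<n + 1] S (0, [])) = Some S'" by (simp add: S'_def)
  then show ?case using Suc.IH[OF d s] Suc.prems(3) by (simp add: timed_defs del: upt_Suc)
qed

text \<open>A set of \<open>s - 1\<close> vertices has no \<open>s\<close>-subset and is vacuously a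
  clique, so the initial list is a correct first level.\<close>

lemma clique_lists_below_uniformity:
  assumes s: "0 < s"
  shows "clique_lists n s E (s - 1) = desc_lists {1..n} (s - 1)"
proof -
  have "nsets (set W) s = {}" if "length W = s - 1" for W :: "nat list"
    by (rule nsets_eq_empty) (use that s card_length[of W] in auto)
  then show ?thesis by (auto simp: clique_lists_def desc_lists_def)
qed

lemma clique_output_eq:
  assumes s: "0 < s" "s \<le> k"
    and "\<And>t. s \<le> t \<Longrightarrow> t \<le> k \<Longrightarrow> real (card (cliques n s E t)) < C t"
  shows "clique_output n s k C E = Some (cliques n s E k)"
proof -
  let ?S = "fst (combinations (s - 1) (rev [1..<n + 1]))"
  have so: "sorted_wrt (>) (rev [1..<n + 1])" by (simp add: sorted_wrt_rev del: upt_Suc)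
  have "set ?S = clique_lists n s E (s - 1)"
    unfolding set_combinations[OF so] clique_lists_below_uniformity[OF s(1)]
    by (simp add: atLeastLessThanSuc_atLeastAtMost del: upt_Suc)
  from fst_generate[OF distinct_combinations[OF so] this, of "k - (s - 1)" C]
  obtain S' where "fst (generate s E C [1..<n + 1] (k - (s - 1)) (s - 1) ?S) = Some S'"
    "set S' = clique_lists n s E k" using assms by auto
  then show ?thesis
    by (simp add: clique_output_def it_gen_cliques_def timed_defs set_image_clique_lists del: upt_Suc)
qed

section \<open>The number of steps\<close>

text \<open>Each entry costs 2 for the loop, at most \<open>2 * i + 1\<close> for the order test, a
  clique test on at most \<open>i + 1\<close> vertices, and at most 3 for storing.\<close>

lemma snd_scan:
  assumes "\<And>A. A \<in> set S \<Longrightarrow> length A \<le> i"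
  shows "snd (scan s E C v S (m, T)) \<le> length S * (2 * i + 6 + (8 * s + 4) * (i + 2) ^ s) + 2"
  using assms
proof (induction S arbitrary: m T)
  case (Cons A S)
  have l: "length A \<le> i" using Cons.prems by auto
  have a: "snd (test_larger v A) \<le> 2 * i + 1" using snd_test_larger[of v A] l by simp
  have "snd (test_clique s E (v # A)) \<le> (8 * s + 4) * (length (v # A) + 1) ^ s"
    by (rule snd_test_clique)
  also have "\<dots> \<le> (8 * s + 4) * (i + 2) ^ s" using l by (intro mult_left_mono power_mono) auto
  finally have b: "snd (test_clique s E (v # A)) \<le> (8 * s + 4) * (i + 2) ^ s" .
  have c: "snd (scan s E C v S (m', T')) \<le> length S * (2 * i + 6 + (8 * s + 4) * (i + 2) ^ s) + 2" for m' T'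
    using Cons by auto
  show ?case using a b c[of m T] c[of "m + 1" "(v # A) # T"]
    by (simp add: timed_defs)
qed (simp add: timed_defs)

text \<open>The end of the list triggers one more comparison, on the final size, so a scan that
  returns a result ends strictly below \<open>C\<close>.\<close>

lemma scan_invariant:
  assumes "fst (scan s E C v S (m, T)) = Some (m', T')" "m = length T"
    "\<And>A. A \<in> set S \<Longrightarrow> length A = i" "\<And>A. A \<in> set T \<Longrightarrow> length A = Suc i"
  shows "real m' < C \<and> m' = length T' \<and> (\<forall>A\<in>set T'. length A = Suc i)"
  using assms
proof (induction S arbitrary: m T)
  case (Cons A S)
  show ?case
  proof (cases "fst (test_larger v A) \<and> fst (test_clique s E (v # A))")
    case True
    then show ?thesis using Cons.prems
      by (intro Cons.IH[of "m + 1" "(v # A) # T"]) (auto simp: timed_defs split: if_splits)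
  next
    case False
    then show ?thesis using Cons.prems
      by (intro Cons.IH[of m T]) (auto simp: timed_defs split: if_splits)
  qed
qed (auto simp: timed_defs split: if_splits)

text \<open>Only scans compare with the cutoff; \<open>vs \<noteq> []\<close> guarantees one, and
  the last scan bounds the result.\<close>

lemma sweep_invariant:
  assumes "fst (sweep s E C vs S (m, T)) = Some T'" "m = length T" "vs \<noteq> []"
    "\<And>A. A \<in> set S \<Longrightarrow> length A = i" "\<And>A. A \<in> set T \<Longrightarrow> length A = Suc i"
  shows "real (length T') < C \<and> (\<forall>A\<in>set T'. length A = Suc i)"
  using assms
proof (induction vs arbitrary: m T)
  case (Cons v vs)
  from Cons.prems(1) obtain m1 T1 where 1: "fst (scan s E C v S (m, T)) = Some (m1, T1)"
    "fst (sweep s E C vs S (m1, T1)) = Some T'"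
    by (auto simp: timed_defs split: option.splits)
  note 2 = scan_invariant[OF 1(1) Cons.prems(2,4,5)]
  show ?case
  proof (cases "vs = []")
    case True
    then show ?thesis using 1 2 by (auto simp: timed_defs)
  next
    case False
    show ?thesis by (rule Cons.IH[OF 1(2) _ False Cons.prems(4)]) (use 2 in auto)
  qed
qed simp

lemma snd_sweep:
  assumes "\<And>A. A \<in> set S \<Longrightarrow> length A \<le> i"
  shows "snd (sweep s E C vs S st) \<le>
    length vs * (length S * (2 * i + 6 + (8 * s + 4) * (i + 2) ^ s) + 3) + 1"
proof (induction vs arbitrary: st)
  case Nil
  then show ?case by (cases st) (simp add: timed_defs)
next
  case (Cons v vs)
  obtain m T where st: "st = (m, T)" by (cases st)
  have a: "snd (scan s E C v S st) \<le> length S * (2 * i + 6 + (8 * s + 4) * (i + 2) ^ s) + 2"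
    unfolding st using assms by (rule snd_scan)
  show ?case
  proof (cases "fst (scan s E C v S st)")
    case None
    then show ?thesis using a by (simp add: timed_defs st)
  next
    case (Some st')
    then show ?thesis using a Cons.IH[of st'] by (simp add: timed_defs st)
  qed
qed

text \<open>\<open>K\<close> bounds the cost per pair of a vertex and a stored set on all levels up
  to \<open>k\<close>, and \<open>B\<close> the length of every list that is swept. The list of
  level \<open>i + r\<close> is output without being swept, whence the strict
  \<open>j < i + r\<close>.\<close>

lemma snd_generate:
  assumes "\<And>A. A \<in> set S \<Longrightarrow> length A = i" "i + r \<le> k" "vs \<noteq> []"
    and "real (length S) \<le> B" "\<And>j. i < j \<Longrightarrow> j < i + r \<Longrightarrow> C j \<le> B"
    and K: "K = 2 * k + 6 + (8 * s + 4) * (k + 2) ^ s"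
  shows "real (snd (generate s E C vs r i S)) \<le> real r * (real (length vs) * (B * real K + 3) + 2) + 1"
  using assms(1-5)
proof (induction r arbitrary: i S)
  case 0
  then show ?case by (simp add: timed_defs)
next
  case (Suc r)
  have "snd (sweep s E (C (Suc i)) vs S (0, [])) \<le> length vs * (length S * K + 3) + 1"
    unfolding K by (rule snd_sweep) (use Suc.prems in auto)
  then have "real (snd (sweep s E (C (Suc i)) vs S (0, []))) \<le> real (length vs * (length S * K + 3) + 1)"
    by (rule of_nat_mono)
  also have "\<dots> = real (length vs) * (real (length S) * real K + 3) + 1"
    by simp
  also have "\<dots> \<le> real (length vs) * (B * real K + 3) + 1"
    using Suc.prems by (intro add_mono mult_left_mono mult_right_mono) auto
  finally have a: "real (snd (sweep s E (C (Suc i)) vs S (0, []))) \<le> real (length vs) * (B * real K + 3) + 1" .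
  have B: "0 \<le> B" using Suc.prems(4) by (meson of_nat_0_le_iff order_trans)
  show ?case
  proof (cases "fst (sweep s E (C (Suc i)) vs S (0, []))")
    case None
    have "0 \<le> real r * (real (length vs) * (B * real K + 3) + 2)" using B by simp
    then show ?thesis using None a by (simp add: timed_defs algebra_simps)
  next
    case (Some T)
    have t: "real (length T) < C (Suc i) \<and> (\<forall>A\<in>set T. length A = Suc i)"
      by (rule sweep_invariant[OF Some]) (use Suc.prems in auto)
    have "real (snd (generate s E C vs r (Suc i) T)) \<le> real r * (real (length vs) * (B * real K + 3) + 2) + 1"
    proof (cases "r = 0")
      case True
      then show ?thesis by (simp add: timed_defs)
    next
      case False
      moreover have "real (length T) \<le> B"
        using False t Suc.prems(5)[of "Suc i"] by simp
      ultimately show ?thesis using t Suc.prems by (intro Suc.IH) auto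
    qed
    then show ?thesis using Some a by (simp add: timed_defs algebra_simps)
  qed
qed

text \<open>The initial list has no cutoff; \<open>real n ^ (s - 1) \<le> B\<close> controls its
  length. The bound is uniform in \<open>E\<close> and so passes to the maximum.\<close>

lemma worst_case_runtime_le:
  assumes s: "0 < s" "s \<le> k" "1 \<le> n"
    and B: "real n ^ (s - 1) \<le> B" "\<And>j. s \<le> j \<Longrightarrow> j < k \<Longrightarrow> C j \<le> B"
    and K: "K = 2 * k + 6 + (8 * s + 4) * (k + 2) ^ s"
  shows "real (worst_case_runtime n s k C) \<le>
     4 * (real n + 1) + (6 * real s + 1) * (real n + 1) ^ (s - 1)
     + real k * (real n * (B * real K + 3) + 2) + 1" (is "_ \<le> ?R")
proof -
  have "real (snd (it_gen_cliques n s k C E)) \<le> ?R" for E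
  proof -
    let ?S = "fst (combinations (s - 1) (rev [1..<n + 1]))"
    have "(n choose (s - 1)) \<le> n ^ (s - 1)"
      by (rule binomial_le_power)
    then have "real (n choose (s - 1)) \<le> real n ^ (s - 1)"
      by (metis of_nat_le_iff of_nat_power)
    then have "real (n choose (s - 1)) \<le> B"
      using B(1) by linarith
    then have l: "real (length ?S) \<le> B"
      by (simp add: length_combinations del: upt_Suc)
    have B0: "0 \<le> B" using l by (meson of_nat_0_le_iff order_trans)
    have "snd (combinations (s - 1) (rev [1..<n + 1])) \<le> (6 * (s - 1) + 1) * (n + 1) ^ (s - 1)"
      using snd_combinations[of "s - 1" "rev [1..<n + 1]"] by (simp del: upt_Suc)
    also have "\<dots> \<le> (6 * s + 1) * (n + 1) ^ (s - 1)" by (intro mult_right_mono) auto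
    finally have 1: "real (snd (combinations (s - 1) (rev [1..<n + 1]))) \<le> real ((6 * s + 1) * (n + 1) ^ (s - 1))"
      by (rule of_nat_mono)
    have "real (snd (generate s E C [1..<n + 1] (k - (s - 1)) (s - 1) ?S))
        \<le> real (k - (s - 1)) * (real (length [1..<n + 1]) * (B * real K + 3) + 2) + 1"
      using s B l by (intro snd_generate[OF _ _ _ _ _ K]) (auto dest: length_mem_combinations simp del: upt_Suc)
    also have "\<dots> \<le> real k * (real n * (B * real K + 3) + 2) + 1"
      using B0 by (intro add_mono mult_mono) (auto simp del: upt_Suc)
    finally show ?thesis using 1 by (simp add: it_gen_cliques_def timed_defs algebra_simps del: upt_Suc)
  qed
  moreover have "finite (Pow (nsets {1..n} s))" by (simp add: finite_imp_finite_nsets)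
  ultimately have "\<forall>x \<in> (\<lambda>E. snd (it_gen_cliques n s k C E)) ` Pow (nsets {1..n} s). real x \<le> ?R"
    by auto
  moreover have "worst_case_runtime n s k C \<in> (\<lambda>E. snd (it_gen_cliques n s k C E)) ` Pow (nsets {1..n} s)"
    unfolding worst_case_runtime_def by (rule Max_in) (auto simp: finite_imp_finite_nsets)
  ultimately show ?thesis by blast
qed

section \<open>The upper tail of the number of cliques\<close>

text \<open>The event \<open>F \<subseteq> G\<close> restricts each edge separately and is a product
  set, with factor \<open>c\<close> for edges of \<open>F\<close> and 1 for all others.\<close>

lemma prob_subset_random_hypergraph:
  assumes F: "F \<subseteq> nsets {1..n} s" and c: "0 \<le> c" "c \<le> 1"
  shows "measure_pmf.prob (random_hypergraph n c s) {G. F \<subseteq> G} = c ^ card F"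
proof -
  let ?A = "nsets {1..n} s"
  have fin: "finite ?A" by (simp add: finite_imp_finite_nsets)
  have "(\<lambda>f. {e \<in> ?A. f e}) -` {G. F \<subseteq> G} = Pi ?A (\<lambda>e. if e \<in> F then {True} else UNIV)"
    using F by (force simp: Pi_iff)
  then have "measure_pmf.prob (random_hypergraph n c s) {G. F \<subseteq> G} =
      (\<Prod>e\<in>?A. measure_pmf.prob (bernoulli_pmf c) (if e \<in> F then {True} else UNIV))"
    unfolding random_hypergraph_def measure_map_pmf by (simp only: measure_Pi_pmf_Pi[OF fin])
  also have "\<dots> = (\<Prod>e\<in>?A. if e \<in> F then c else 1)"
    using c by (intro prod.cong) (auto simp: measure_pmf_single)
  also have "\<dots> = (\<Prod>e\<in>F. c)"
    using F fin by (simp add: prod.If_cases Int_absorb1 flip: prod.inter_restrict)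
  finally show ?thesis by simp
qed

lemma finite_set_pmf_random_hypergraph: "finite (set_pmf (random_hypergraph n c s))"
  by (rule finite_subset[of _ "Pow (nsets {1..n} s)"])
     (auto simp: random_hypergraph_def finite_imp_finite_nsets)

lemma card_cliques_sum:
  "real (card (cliques n s G t)) = (\<Sum>W\<in>nsets {1..n} t. indicator {G. nsets W s \<subseteq> G} G)"
proof -
  have "finite (nsets {1..n} t)" by (simp add: finite_imp_finite_nsets)
  then show ?thesis
    by (simp add: cliques_def indicator_def Int_def flip: of_nat_sum)
qed

text \<open>
  Carrying the event \<open>F \<subseteq> G\<close> for an arbitrary edge set \<open>F\<close> on few vertices makes the induction on
  the order of the moment work: each factor \<open>X\<^sub>t\<close> adds the edges of one more \<open>t\<close>-set to \<open>F\<close>.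
\<close>

lemma clique_moment_bound:
  fixes c B :: real
  assumes c: "0 \<le> c" "c \<le> 1" and B0: "0 \<le> B"
    and B: "\<And>V F. V \<subseteq> {1..n} \<Longrightarrow> card V \<le> L \<Longrightarrow> F \<subseteq> nsets V s \<Longrightarrow>
             (\<Sum>W\<in>nsets {1..n} t. c ^ card (nsets W s - F)) \<le> B"
    and "V \<subseteq> {1..n}" "F \<subseteq> nsets V s" "card V + m * t \<le> L"
  shows "measure_pmf.expectation (random_hypergraph n c s)
           (\<lambda>G. indicator {G. F \<subseteq> G} G * real (card (cliques n s G t)) ^ m) \<le> c ^ card F * B ^ m"
  using assms(5-)
proof (induction m arbitrary: V F)
  case 0
  have "F \<subseteq> nsets {1..n} s" using 0 nsets_mono by blast
  then show ?case using prob_subset_random_hypergraph[of F n s c] c by simp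
next
  case (Suc m)
  let ?E = "measure_pmf.expectation (random_hypergraph n c s)"
  have finF: "finite F"
    using Suc.prems by (meson finite_imp_finite_nsets finite_subset finite_atLeastAtMost)
  \<comment> \<open>One factor of the power becomes a sum of indicators;
    \<open>F \<subseteq> G\<close> and \<open>nsets W s \<subseteq> G\<close> merge into one
    event.\<close>
  have "?E (\<lambda>G. indicator {G. F \<subseteq> G} G * real (card (cliques n s G t)) ^ Suc m) =
      ?E (\<lambda>G. \<Sum>W\<in>nsets {1..n} t. indicator {G. F \<union> nsets W s \<subseteq> G} G * real (card (cliques n s G t)) ^ m)"
    unfolding power_Suc
    by (subst (1) card_cliques_sum)
       (auto simp: sum_distrib_left sum_distrib_right indicator_def intro!: Bochner_Integration.integral_cong sum.cong)
  also have "\<dots> = (\<Sum>W\<in>nsets {1..n} t. ?E (\<lambda>G. indicator {G. F \<union> nsets W s \<subseteq> G} G * real (card (cliques n s G t)) ^ m))"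
    by (intro Bochner_Integration.integral_sum integrable_measure_pmf_finite finite_set_pmf_random_hypergraph)
  also have "\<dots> \<le> (\<Sum>W\<in>nsets {1..n} t. c ^ card F * B ^ m * c ^ card (nsets W s - F))"
  proof (rule sum_mono)
    fix W assume W: "W \<in> nsets {1..n} t"
    then have W': "W \<subseteq> {1..n}" "finite W" "card W = t" by (auto simp: nsets_def)
    \<comment> \<open>The new set uses up \<open>t\<close> vertices of the budget \<open>L\<close>,
      which lowering the order by one releases.\<close>
    have "card (V \<union> W) \<le> card V + t" using card_Un_le[of V W] W' by simp
    then have "?E (\<lambda>G. indicator {G. F \<union> nsets W s \<subseteq> G} G * real (card (cliques n s G t)) ^ m)
        \<le> c ^ card (F \<union> nsets W s) * B ^ m"
      using Suc.prems W' nsets_mono[of V "V \<union> W" s] nsets_mono[of W "V \<union> W" s]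
      by (intro Suc.IH[of "V \<union> W"]) auto
    also have "card (F \<union> nsets W s) = card F + card (nsets W s - F)"
      using finF W' by (subst card_Un_disjoint[symmetric]) (auto simp: finite_imp_finite_nsets)
    finally show "?E (\<lambda>G. indicator {G. F \<union> nsets W s \<subseteq> G} G * real (card (cliques n s G t)) ^ m)
        \<le> c ^ card F * B ^ m * c ^ card (nsets W s - F)" by (simp add: power_add mult_ac)
  qed
  also have "\<dots> = c ^ card F * B ^ m * (\<Sum>W\<in>nsets {1..n} t. c ^ card (nsets W s - F))"
    by (simp add: sum_distrib_left)
  also have "\<dots> \<le> c ^ card F * B ^ m * B"
    using Suc.prems c B0 by (intro mult_left_mono B[of V]) auto
  finally show ?case by (simp add: mult_ac)
qed

text \<open>Markov's inequality for the \<open>m\<close>-th power. Starting from no vertices,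
  \<open>m\<close> successive \<open>t\<close>-sets span at most \<open>m * t\<close>
  vertices.\<close>

lemma clique_upper_tail:
  fixes c B a :: real
  assumes c: "0 \<le> c" "c \<le> 1" and B0: "0 \<le> B"
    and B: "\<And>V F. V \<subseteq> {1..n} \<Longrightarrow> card V \<le> m * t \<Longrightarrow> F \<subseteq> nsets V s \<Longrightarrow>
             (\<Sum>W\<in>nsets {1..n} t. c ^ card (nsets W s - F)) \<le> B"
    and a: "0 < a"
  shows "measure_pmf.prob (random_hypergraph n c s) {G. a \<le> real (card (cliques n s G t))} \<le> (B / a) ^ m"
proof -
  let ?X = "\<lambda>G. real (card (cliques n s G t))"
  have "measure_pmf.prob (random_hypergraph n c s) {G. a \<le> ?X G}
      \<le> measure_pmf.prob (random_hypergraph n c s) {G \<in> space (measure_pmf (random_hypergraph n c s)). ?X G ^ m \<ge> a ^ m}"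
    using a by (intro measure_pmf.finite_measure_mono) (auto intro: power_mono)
  also have "\<dots> \<le> measure_pmf.expectation (random_hypergraph n c s) (\<lambda>G. ?X G ^ m) / a ^ m"
    using a by (intro integral_Markov_inequality_measure[where A = "{}"])
      (auto intro: integrable_measure_pmf_finite finite_set_pmf_random_hypergraph)
  also have "measure_pmf.expectation (random_hypergraph n c s) (\<lambda>G. ?X G ^ m) \<le> B ^ m"
    using clique_moment_bound[OF c B0 B, where V = "{}" and F = "{}" and m = m and L = "m * t"]
    by (simp add: nsets_def)
  finally show ?thesis using a by (simp add: power_divide divide_right_mono)
qed

section \<open>Overlaps with the vertices already used\<close>

text \<open>The sets \<open>W\<close> are grouped by \<open>j = card (W \<inter> V)\<close>. Edges
  of \<open>F\<close> lie inside \<open>V\<close>, so at most \<open>j choose s\<close> edges of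
  \<open>W\<close> come for free; \<open>W\<close> is determined by its parts inside and outside
  \<open>V\<close>, which leaves at most \<open>L ^ j * n ^ (t - j)\<close> choices.\<close>

lemma sum_overlap_le:
  fixes c :: real
  assumes c: "0 \<le> c" "c \<le> 1"
    and V: "V \<subseteq> {1..n}" "card V \<le> L" "F \<subseteq> nsets V s"
  shows "(\<Sum>W\<in>nsets {1..n} t. c ^ card (nsets W s - F))
       \<le> (\<Sum>j\<le>t. real L ^ j * real n ^ (t - j) * c ^ ((t choose s) - (j choose s)))"
proof -
  let ?N = "nsets {1..n} t"
  have fin: "finite ?N" by (simp add: finite_imp_finite_nsets)
  have finV: "finite V" using V finite_subset by blast
  have "(\<Sum>W\<in>?N. c ^ card (nsets W s - F)) =
      (\<Sum>j\<le>t. \<Sum>W\<in>{W\<in>?N. card (W \<inter> V) = j}. c ^ card (nsets W s - F))"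
    by (rule sum.group[symmetric]) (use fin in \<open>auto simp: nsets_def intro: card_mono\<close>)
  also have "\<dots> \<le> (\<Sum>j\<le>t. real L ^ j * real n ^ (t - j) * c ^ ((t choose s) - (j choose s)))"
  proof (rule sum_mono)
    fix j assume "j \<in> {..t}"
    let ?S = "{W\<in>?N. card (W \<inter> V) = j}"
    have "c ^ card (nsets W s - F) \<le> c ^ ((t choose s) - (j choose s))" if W: "W \<in> ?S" for W
    proof (rule power_decreasing)
      have f: "finite W" "card W = t" using W by (auto simp: nsets_def)
      have "(t choose s) - (j choose s) = card (nsets W s) - card (nsets (W \<inter> V) s)"
        using W f by (simp add: card_nsets)
      also have "\<dots> \<le> card (nsets W s - nsets (W \<inter> V) s)"
        by (rule diff_card_le_card_Diff) (use f in \<open>simp add: finite_imp_finite_nsets\<close>)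
      also have "\<dots> \<le> card (nsets W s - F)"
        using f V by (intro card_mono) (auto simp: finite_imp_finite_nsets nsets_def)
      finally show "(t choose s) - (j choose s) \<le> card (nsets W s - F)" .
    qed (use c in auto)
    then have "(\<Sum>W\<in>?S. c ^ card (nsets W s - F)) \<le> (\<Sum>W\<in>?S. c ^ ((t choose s) - (j choose s)))"
      by (rule sum_mono)
    also have "\<dots> = real (card ?S) * c ^ ((t choose s) - (j choose s))" by simp
    also have "\<dots> \<le> real L ^ j * real n ^ (t - j) * c ^ ((t choose s) - (j choose s))"
    proof (rule mult_right_mono)
      have "card ?S \<le> card (nsets V j \<times> nsets {1..n} (t - j))"
      proof (rule card_inj_on_le[where f = "\<lambda>W. (W \<inter> V, W - V)"])
        show "inj_on (\<lambda>W. (W \<inter> V, W - V)) ?S" by (rule inj_onI) blast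
        show "(\<lambda>W. (W \<inter> V, W - V)) ` ?S \<subseteq> nsets V j \<times> nsets {1..n} (t - j)"
          using finV by (auto simp: nsets_def card_Diff_subset_Int)
        show "finite (nsets V j \<times> nsets {1..n} (t - j))"
          using finV by (simp add: finite_imp_finite_nsets)
      qed
      also have "\<dots> = (card V choose j) * (n choose (t - j))"
        using finV by (simp add: card_cartesian_product card_nsets)
      also have "\<dots> \<le> L ^ j * n ^ (t - j)"
        using V by (intro mult_mono order.trans[OF binomial_le_power] power_mono) auto
      finally show "real (card ?S) \<le> real L ^ j * real n ^ (t - j)"
        by (metis of_nat_le_iff of_nat_mult of_nat_power)
    qed (use c in simp)
    finally show "(\<Sum>W\<in>?S. c ^ card (nsets W s - F))
        \<le> real L ^ j * real n ^ (t - j) * c ^ ((t choose s) - (j choose s))" .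
  qed
  finally show ?thesis .
qed

text \<open>The empty overlap contributes \<open>N\<close>, since \<open>0 choose s = 0\<close>; by
  \<open>small\<close> the others add at most \<open>N / 2\<close>. Against the cutoff
  \<open>2 * N\<close> the ratio is \<open>3 / 4\<close>.\<close>

lemma clique_upper_tail_cutoff:
  fixes c :: real
  assumes c: "0 < c" "c \<le> 1" and n: "1 \<le> n" and s: "0 < s"
    and small: "(\<Sum>j\<in>{1..t}. real (m * t) ^ j / (real n ^ j * c ^ (j choose s))) \<le> 1 / 2"
  shows "measure_pmf.prob (random_hypergraph n c s) {G. cutoff n c s t \<le> real (card (cliques n s G t))} \<le> (3 / 4) ^ m"
proof -
  define N where "N = real n ^ t * c ^ (t choose s)"
  have N: "0 < N" using c n by (simp add: N_def)
  have "(\<Sum>W\<in>nsets {1..n} t. c ^ card (nsets W s - F)) \<le> 3 / 2 * N"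
    if "V \<subseteq> {1..n}" "card V \<le> m * t" "F \<subseteq> nsets V s" for V F
  proof -
    have "(\<Sum>W\<in>nsets {1..n} t. c ^ card (nsets W s - F))
       \<le> (\<Sum>j\<le>t. real (m * t) ^ j * real n ^ (t - j) * c ^ ((t choose s) - (j choose s)))"
      by (rule sum_overlap_le) (use c that in auto)
    also have "\<dots> = (\<Sum>j\<le>t. N * (real (m * t) ^ j / (real n ^ j * c ^ (j choose s))))"
      using c n by (intro sum.cong) (auto simp: N_def power_diff binomial_right_mono field_simps)
    also have "\<dots> = N * (\<Sum>j\<le>t. real (m * t) ^ j / (real n ^ j * c ^ (j choose s)))"
      by (simp add: sum_distrib_left)
    also have "(\<Sum>j\<le>t. real (m * t) ^ j / (real n ^ j * c ^ (j choose s))) =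
        1 + (\<Sum>j\<in>{1..t}. real (m * t) ^ j / (real n ^ j * c ^ (j choose s)))"
      using s by (simp add: atMost_atLeast0 sum.atLeast_Suc_atMost binomial_eq_0)
    also have "N * \<dots> \<le> N * (3 / 2)" using small N by (intro mult_left_mono) auto
    finally show ?thesis by simp
  qed
  then have "measure_pmf.prob (random_hypergraph n c s) {G. 2 * N \<le> real (card (cliques n s G t))}
      \<le> (3 / 2 * N / (2 * N)) ^ m"
    using c N by (intro clique_upper_tail) auto
  moreover have "cutoff n c s t = 2 * N" by (simp add: cutoff_def N_def)
  ultimately show ?thesis using N by simp
qed

section \<open>Asymptotics\<close>

text \<open>The square outgrows every multiple of \<open>ln n\<close>, which makes
  \<open>(3 / 4) ^ moment_order n\<close> superpolynomially small, yet all powers of it are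
  negligible against any positive power of \<open>n\<close>.\<close>

definition moment_order :: "nat \<Rightarrow> nat" where
  "moment_order n = nat \<lceil>(ln (real n))\<^sup>2\<rceil>"

lemma moment_order_ge: "(ln (real n))\<^sup>2 \<le> real (moment_order n)"
  unfolding moment_order_def by linarith

lemma moment_order_le: "real (moment_order n) \<le> (ln (real n))\<^sup>2 + 1"
  unfolding moment_order_def by (smt (verit) ceiling_correct of_nat_nat zero_le_ceiling zero_le_power2)

text \<open>Up to a constant, \<open>f n\<close> is at most \<open>n\<close> to the power
  \<open>- ln (4 / 3) * ln n\<close>, and this exponent tends to minus infinity.\<close>

lemma superpoly_small_moment_order:
  assumes "eventually (\<lambda>n. \<bar>f n\<bar> \<le> real k * (3 / 4) ^ moment_order n) sequentially"
  shows "superpoly_small f"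
  unfolding superpoly_small_def
proof
  fix d :: nat
  have "(\<lambda>n. real k * (3 / 4) powr ((ln (real n))\<^sup>2)) \<in> o(\<lambda>n. real n powr (- real d))"
    by real_asymp
  moreover have "f \<in> O(\<lambda>n. real k * (3 / 4) powr ((ln (real n))\<^sup>2))"
  proof (rule bigoI[where c = 1], rule eventually_mono[OF assms])
    fix n assume "\<bar>f n\<bar> \<le> real k * (3 / 4) ^ moment_order n"
    also have "(3 / 4 :: real) ^ moment_order n = (3 / 4) powr real (moment_order n)"
      by (simp add: powr_realpow)
    also have "\<dots> \<le> (3 / 4) powr ((ln (real n))\<^sup>2)"
      using moment_order_ge by (intro powr_mono') auto
    finally show "norm (f n) \<le> 1 * norm (real k * (3 / 4) powr ((ln (real n))\<^sup>2))"
      by (simp add: mult_left_mono)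
  qed
  ultimately show "f \<in> o(\<lambda>n. real n powr (- real d))"
    using landau_o.big_small_trans by blast
qed

text \<open>As \<open>c n\<close> stands in the denominator, its lower bound is what matters: it
  leaves a polylogarithm divided by \<open>n\<close> to the positive power
  \<open>j - \<alpha> * e\<close>.\<close>

lemma overlap_term_tendsto_0:
  fixes c :: "nat \<Rightarrow> real" and e :: nat
  assumes K: "0 < K" "eventually (\<lambda>n. K * real n powr (- \<alpha>) \<le> c n) sequentially"
    and e: "\<alpha> * real e < real j"
  shows "(\<lambda>n. real (moment_order n * t) ^ j / (real n ^ j * c n ^ e)) \<longlonglongrightarrow> 0"
proof (rule tendsto_sandwich[where f = "\<lambda>_. 0"])
  define \<epsilon> where "\<epsilon> = real j - \<alpha> * real e"
  have \<epsilon>: "0 < \<epsilon>" using e by (simp add: \<epsilon>_def)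
  show "(\<lambda>n. real t ^ j * ((ln (real n))\<^sup>2 + 1) ^ j / K ^ e * real n powr (- \<epsilon>)) \<longlonglongrightarrow> 0"
    using \<epsilon> K(1) by real_asymp
  show "eventually (\<lambda>n. 0 \<le> real (moment_order n * t) ^ j / (real n ^ j * c n ^ e)) sequentially"
    using K(2) eventually_gt_at_top[of 0]
  proof eventually_elim
    case (elim n)
    have "0 \<le> c n" using elim K(1) by (meson less_imp_le mult_nonneg_nonneg order_trans powr_ge_zero)
    then show ?case by simp
  qed
  show "eventually (\<lambda>n. real (moment_order n * t) ^ j / (real n ^ j * c n ^ e)
      \<le> real t ^ j * ((ln (real n))\<^sup>2 + 1) ^ j / K ^ e * real n powr (- \<epsilon>)) sequentially"
    using K(2) eventually_gt_at_top[of 0]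
  proof eventually_elim
    case (elim n)
    have "K ^ e * real n powr \<epsilon> = real n ^ j * (K * real n powr (- \<alpha>)) ^ e"
      using elim by (simp add: \<epsilon>_def power_mult_distrib powr_diff powr_realpow powr_minus
          powr_powr[symmetric] power_inverse divide_inverse flip: powr_realpow)
    also have "\<dots> \<le> real n ^ j * c n ^ e"
      using elim K(1) by (intro mult_left_mono power_mono) auto
    finally have d: "K ^ e * real n powr \<epsilon> \<le> real n ^ j * c n ^ e" .
    have "real (moment_order n * t) ^ j / (real n ^ j * c n ^ e)
       \<le> (real t ^ j * ((ln (real n))\<^sup>2 + 1) ^ j) / (K ^ e * real n powr \<epsilon>)"
      using moment_order_le[of n] d K(1) elim
      by (intro frac_le) (auto simp: power_mult_distrib mult.commute intro!: mult_left_mono power_mono)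
    then show ?case by (simp add: powr_minus field_simps)
  qed
qed auto

lemma eventually_overlap_sum_small:
  fixes c :: "nat \<Rightarrow> real"
  assumes K: "0 < K" "eventually (\<lambda>n. K * real n powr (- \<alpha>) \<le> c n) sequentially"
    and e: "\<And>j. 1 \<le> j \<Longrightarrow> j \<le> t \<Longrightarrow> \<alpha> * real (j choose s) < real j"
  shows "eventually (\<lambda>n. (\<Sum>j\<in>{1..t}. real (moment_order n * t) ^ j / (real n ^ j * c n ^ (j choose s))) \<le> 1 / 2) sequentially"
proof -
  have "(\<lambda>n. \<Sum>j\<in>{1..t}. real (moment_order n * t) ^ j / (real n ^ j * c n ^ (j choose s))) \<longlonglongrightarrow> (\<Sum>j\<in>{1..t}. 0)"
    by (intro tendsto_sum overlap_term_tendsto_0[OF K] e) auto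
  then have "(\<lambda>n. \<Sum>j\<in>{1..t}. real (moment_order n * t) ^ j / (real n ^ j * c n ^ (j choose s))) \<longlonglongrightarrow> 0"
    by simp
  from order_tendstoD(2)[OF this, of "1 / 2"] show ?thesis
    by (auto elim: eventually_mono)
qed

section \<open>Exponents of clique counts\<close>

text \<open>By \<open>s * (j choose s) = j * ((j - 1) choose (s - 1))\<close> the claim reduces to
  the bound on \<open>\<kappa>\<close>, as \<open>j - 1 \<le> \<kappa>\<close>; hence the range up
  to \<open>\<kappa> + 1\<close>.\<close>

lemma mult_binomial_less:
  assumes "0 < \<alpha>" "0 < s" "1 \<le> j" "j \<le> \<kappa> + 1" "\<alpha> * real (\<kappa> choose (s - 1)) < real s"
  shows "\<alpha> * real (j choose s) < real j"
proof -
  have "real s * real (j choose s) = real j * real ((j - 1) choose (s - 1))"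
    using times_binomial_minus1_eq[OF assms(2), of j] by (metis of_nat_mult)
  moreover have "\<alpha> * real ((j - 1) choose (s - 1)) \<le> \<alpha> * real (\<kappa> choose (s - 1))"
    using assms by (intro mult_left_mono) (auto intro: binomial_right_mono)
  ultimately have "real s * (\<alpha> * real (j choose s)) = real j * (\<alpha> * real ((j - 1) choose (s - 1)))"
    and "\<alpha> * real ((j - 1) choose (s - 1)) < real s"
    using assms(5) by (simp_all only: mult_ac)
  then have "real s * (\<alpha> * real (j choose s)) < real s * real j"
    using assms mult_strict_left_mono[of "\<alpha> * real ((j - 1) choose (s - 1))" "real s" "real j"]
    by (simp add: mult_ac)
  then show ?thesis using assms by simp
qed

lemma growth_exponent_Suc:
  assumes "0 < s"
  shows "real (Suc j) - \<alpha> * real (Suc j choose s) = 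
    real j - \<alpha> * real (j choose s) + (1 - \<alpha> * real (j choose (s - 1)))"
  using assms by (cases s) (auto simp: algebra_simps)

text \<open>Only increments at indices up to \<open>\<tau>\<close> are used, and they are positive
  because the binomial is monotone.\<close>

lemma growth_exponent_mono:
  assumes "0 < s" "0 < \<alpha>" "\<alpha> * real (\<tau> choose (s - 1)) < 1" "j \<le> i" "i \<le> \<tau> + 1"
  shows "real j - \<alpha> * real (j choose s) \<le> real i - \<alpha> * real (i choose s)"
  using assms(4,5)
proof (induction i rule: dec_induct)
  case (step i)
  have "\<alpha> * real (i choose (s - 1)) \<le> \<alpha> * real (\<tau> choose (s - 1))"
    using assms step by (intro mult_left_mono) (auto intro: binomial_right_mono)
  then have "\<alpha> * real (i choose (s - 1)) < 1" using assms(3) by linarith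
  moreover have "real j - \<alpha> * real (j choose s) \<le> real i - \<alpha> * real (i choose s)"
    using step by simp
  ultimately show ?case unfolding growth_exponent_Suc[OF assms(1)] by linarith
qed simp

text \<open>The exponent rises up to \<open>\<tau> + 1\<close>; beyond that, maximality of
  \<open>\<tau>\<close> makes every increment nonpositive.\<close>

lemma growth_exponent_max:
  assumes "0 < s" "0 < \<alpha>" "\<alpha> * real (\<tau> choose (s - 1)) < 1"
    and "\<And>m::nat. \<alpha> * real (m choose (s - 1)) < 1 \<Longrightarrow> m \<le> \<tau>"
  shows "real j - \<alpha> * real (j choose s) \<le> real (\<tau> + 1) - \<alpha> * real ((\<tau> + 1) choose s)"
proof (cases "j \<le> \<tau> + 1")
  case True
  then show ?thesis using growth_exponent_mono[OF assms(1-3) True] by simp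
next
  case False
  then have "\<tau> + 1 \<le> j" by simp
  then show ?thesis
  proof (induction j rule: dec_induct)
    case (step i)
    then have "\<not> \<alpha> * real (i choose (s - 1)) < 1" using assms(4)[of i] by auto
    then show ?case using step assms by (simp add: growth_exponent_Suc del: binomial_Suc_Suc of_nat_Suc)
  qed simp
qed

section \<open>Order of growth of the runtime\<close>

lemma cutoff_le_powr:
  assumes "1 \<le> n" "0 \<le> D" "0 \<le> c" "c \<le> D * real n powr (- \<alpha>)"
    and "real t - \<alpha> * real (t choose s) \<le> g"
  shows "cutoff n c s t \<le> 2 * D ^ (t choose s) * real n powr g"
proof -
  have "cutoff n c s t \<le> 2 * real n ^ t * (D * real n powr (- \<alpha>)) ^ (t choose s)"
    using assms unfolding cutoff_def by (intro mult_left_mono power_mono) auto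
  also have "\<dots> = 2 * D ^ (t choose s) * real n powr (real t - \<alpha> * real (t choose s))"
    using assms by (simp add: power_mult_distrib powr_diff powr_realpow powr_minus
          powr_powr[symmetric] power_inverse divide_inverse flip: powr_realpow)
  also have "\<dots> \<le> 2 * D ^ (t choose s) * real n powr g"
    using assms by (intro mult_left_mono powr_mono) auto
  finally show ?thesis .
qed

text \<open>The main term is \<open>n\<close> times \<open>n powr g\<close>; since \<open>g\<close>
  is at least \<open>s - 1\<close>, it also absorbs the initial listing and the linear
  overhead.\<close>

lemma runtime_bound_bigo:
  fixes g D K :: real and s k :: nat
  assumes g: "real (s - 1) \<le> g" "0 < s"
  shows "(\<lambda>n. 4 * (real n + 1) + (6 * real s + 1) * (real n + 1) ^ (s - 1)
     + real k * (real n * (D * real n powr g * K + 3) + 2) + 1) \<in> O(\<lambda>n. real n powr (g + 1))"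
proof -
  have g0: "0 \<le> g" using g by linarith
  have 1: "(\<lambda>n. 1) \<in> O(\<lambda>n. real n powr (g + 1))" using g0 by real_asymp
  have 2: "(\<lambda>n. real n) \<in> O(\<lambda>n. real n powr (g + 1))"
    by (rule bigoI[of _ 1], rule eventually_mono[OF eventually_ge_at_top[of 1]])
       (use g0 powr_mono[of 1 "g + 1"] in auto)
  have 3: "(\<lambda>n. real n * (D * real n powr g * K)) \<in> O(\<lambda>n. real n powr (g + 1))"
    by (rule bigoI[of _ "\<bar>D * K\<bar>"], rule eventually_mono[OF eventually_ge_at_top[of 1]])
       (auto simp: powr_add abs_mult)
  have 4: "(\<lambda>n. (real n + 1) ^ (s - 1)) \<in> O(\<lambda>n. real n powr (g + 1))"
  proof (rule bigoI[of _ "2 ^ (s - 1)"], rule eventually_mono[OF eventually_ge_at_top[of 1]])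
    fix n :: nat assume n: "1 \<le> n"
    have "(real n + 1) ^ (s - 1) \<le> (2 * real n) ^ (s - 1)" using n by (intro power_mono) auto
    also have "\<dots> = 2 ^ (s - 1) * real n powr real (s - 1)"
      using n by (simp add: power_mult_distrib powr_realpow)
    also have "\<dots> \<le> 2 ^ (s - 1) * real n powr (g + 1)"
      using n g by (intro mult_left_mono powr_mono) auto
    finally show "norm ((real n + 1) ^ (s - 1)) \<le> 2 ^ (s - 1) * norm (real n powr (g + 1))" by simp
  qed
  have cm: "(\<lambda>n. a * f n) \<in> O(\<lambda>n. real n powr (g + 1))" if "f \<in> O(\<lambda>n. real n powr (g + 1))"
    for a and f :: "nat \<Rightarrow> real"
    using that by (cases "a = 0") auto
  have "(\<lambda>n. 4 * real n + 5 * 1 + (6 * real s + 1) * (real n + 1) ^ (s - 1)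
     + real k * (real n * (D * real n powr g * K) + 3 * real n + 2 * 1)) \<in> O(\<lambda>n. real n powr (g + 1))"
    by (rule sum_in_bigo(1) cm 1 2 3 4)+
  then show ?thesis by (simp add: algebra_simps)
qed

lemma runtime_bigo:
  fixes c :: "nat \<Rightarrow> real" and g D :: real
  assumes s: "0 < s" "s \<le> k" and D: "0 \<le> D"
    and c: "\<And>n. 0 \<le> c n" "eventually (\<lambda>n. c n \<le> D * real n powr (- \<alpha>)) sequentially"
    and g: "\<And>j. s - 1 \<le> j \<Longrightarrow> j < k \<Longrightarrow> real j - \<alpha> * real (j choose s) \<le> g"
  shows "(\<lambda>n. real (worst_case_runtime n s k (cutoff n (c n) s))) \<in> O(\<lambda>n. real n powr (g + 1))"
proof -
  \<comment> \<open>One constant for all levels: it dominates every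
    \<open>2 * D ^ (j choose s)\<close>, and the added 1 lets \<open>D' * n powr g\<close> bound
    \<open>n ^ (s - 1)\<close> as well.\<close>
  define D' where "D' = (\<Sum>j\<le>k. 2 * D ^ (j choose s)) + 1"
  define K where "K = 2 * k + 6 + (8 * s + 4) * (k + 2) ^ s"
  have D': "2 * D ^ (j choose s) \<le> D'" if "j \<le> k" for j
    using member_le_sum[of j "{..k}" "\<lambda>j. 2 * D ^ (j choose s)"] that D by (simp add: D'_def)
  have D'1: "1 \<le> D'" using D by (simp add: D'_def sum_nonneg)
  have gs: "real (s - 1) \<le> g" using g[of "s - 1"] s by (simp add: binomial_eq_0)
  let ?R = "\<lambda>n. 4 * (real n + 1) + (6 * real s + 1) * (real n + 1) ^ (s - 1)
     + real k * (real n * (D' * real n powr g * real K + 3) + 2) + 1"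
  have "(\<lambda>n. real (worst_case_runtime n s k (cutoff n (c n) s))) \<in> O(?R)"
  proof (rule bigoI[of _ 1])
    show "eventually (\<lambda>n. norm (real (worst_case_runtime n s k (cutoff n (c n) s))) \<le> 1 * norm (?R n)) sequentially"
      using c(2) eventually_ge_at_top[of 1]
    proof eventually_elim
      case (elim n)
      have "real n ^ (s - 1) = real n powr real (s - 1)" using elim by (simp add: powr_realpow)
      also have "\<dots> \<le> real n powr g" using elim gs by (intro powr_mono) auto
      also have "\<dots> \<le> D' * real n powr g"
        using mult_right_mono[OF D'1, of "real n powr g"] by simp
      finally have 1: "real n ^ (s - 1) \<le> D' * real n powr g" .
      have 2: "cutoff n (c n) s j \<le> D' * real n powr g" if "s \<le> j" "j < k" for j
      proof -
        have "cutoff n (c n) s j \<le> 2 * D ^ (j choose s) * real n powr g"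
          using elim c D that g[of j] by (intro cutoff_le_powr[where \<alpha> = \<alpha>]) auto
        also have "\<dots> \<le> D' * real n powr g" using D'[of j] that by (intro mult_right_mono) auto
        finally show ?thesis .
      qed
      have "real (worst_case_runtime n s k (cutoff n (c n) s)) \<le> ?R n"
        using s elim 1 2 by (intro worst_case_runtime_le[OF _ _ _ _ _ K_def]) auto
      then show ?case by simp
    qed
  qed
  also have "?R \<in> O(\<lambda>n. real n powr (g + 1))"
    by (rule runtime_bound_bigo[OF gs s(1)])
  finally show ?thesis .
qed

text \<open>A union bound: failure forces some level \<open>t\<close> in \<open>{s..k}\<close> to
  reach its cutoff, and the number of levels does not depend on \<open>n\<close>.\<close>

lemma success_probability:
  fixes c :: "nat \<Rightarrow> real"
  assumes s: "0 < s" "s \<le> k"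
    and c: "\<And>n. 0 \<le> c n \<and> c n \<le> 1"
    and K: "0 < K" "eventually (\<lambda>n. K * real n powr (- \<alpha>) \<le> c n) sequentially"
    and e: "\<And>j. 1 \<le> j \<Longrightarrow> j \<le> k \<Longrightarrow> \<alpha> * real (j choose s) < real j"
  shows "superpoly_small (\<lambda>n. 1 - measure_pmf.prob (random_hypergraph n (c n) s)
           {G. clique_output n s k (cutoff n (c n) s) G = Some (cliques n s G k)})"
proof (rule superpoly_small_moment_order)
  have "eventually (\<lambda>n. \<forall>t\<in>{s..k}. (\<Sum>j\<in>{1..t}. real (moment_order n * t) ^ j / (real n ^ j * c n ^ (j choose s))) \<le> 1 / 2) sequentially"
    by (intro eventually_ball_finite ballI eventually_overlap_sum_small[OF K] e) auto
  then show "eventually (\<lambda>n. \<bar>1 - measure_pmf.prob (random_hypergraph n (c n) s)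
           {G. clique_output n s k (cutoff n (c n) s) G = Some (cliques n s G k)}\<bar>
       \<le> real (card {s..k}) * (3 / 4) ^ moment_order n) sequentially"
    using K(2) eventually_ge_at_top[of 1]
  proof eventually_elim
    case (elim n)
    let ?P = "measure_pmf.prob (random_hypergraph n (c n) s)"
    let ?A = "{G. clique_output n s k (cutoff n (c n) s) G = Some (cliques n s G k)}"
    let ?B = "\<lambda>t. {G. cutoff n (c n) s t \<le> real (card (cliques n s G t))}"
    have "0 < K * real n powr (- \<alpha>)" using K(1) elim by simp
    then have cn: "0 < c n" using elim by linarith
    have "\<bar>1 - ?P ?A\<bar> = ?P (- ?A)"
      using measure_pmf.prob_compl[of ?A "random_hypergraph n (c n) s"]
      by (simp add: Compl_eq_Diff_UNIV)
    also have "\<dots> \<le> ?P (\<Union>t\<in>{s..k}. ?B t)"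
    proof (rule measure_pmf.finite_measure_mono)
      show "- ?A \<subseteq> (\<Union>t\<in>{s..k}. ?B t)"
      proof
        fix G assume "G \<in> - ?A"
        then have "\<not> (\<forall>t. s \<le> t \<longrightarrow> t \<le> k \<longrightarrow> real (card (cliques n s G t)) < cutoff n (c n) s t)"
          using clique_output_eq[OF s, of n G "cutoff n (c n) s"] by blast
        then show "G \<in> (\<Union>t\<in>{s..k}. ?B t)" by (auto simp: not_less)
      qed
    qed simp
    also have "\<dots> \<le> (\<Sum>t\<in>{s..k}. ?P (?B t))"
      by (rule measure_pmf.finite_measure_subadditive_finite) auto
    also have "\<dots> \<le> (\<Sum>t\<in>{s..k}. (3 / 4) ^ moment_order n)"
      using elim cn c s by (intro sum_mono clique_upper_tail_cutoff) auto
    finally show ?case by simp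
  qed
qed

theorem theorem5p6:
  fixes s k \<tau> \<kappa> :: nat and \<alpha> :: real and c :: "nat \<Rightarrow> real"
  assumes "2 \<le> s" and "s \<le> k"
    and "0 < \<alpha>" and "\<alpha> < 1"
    and c_prob: "\<And>n. 0 \<le> c n \<and> c n \<le> 1"
    and c_Theta: "c \<in> \<Theta>(\<lambda>n. real n powr (- \<alpha>))"
    and \<tau>: "\<alpha> * real (\<tau> choose (s - 1)) < 1"
           "\<And>m::nat. \<alpha> * real (m choose (s - 1)) < 1 \<Longrightarrow> m \<le> \<tau>"
    and \<kappa>: "\<alpha> * real (\<kappa> choose (s - 1)) < real s"
           "\<And>m::nat. \<alpha> * real (m choose (s - 1)) < real s \<Longrightarrow> m \<le> \<kappa>"
  defines "C \<equiv> \<lambda>n t. cutoff n (c n) s t"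
  defines "success \<equiv> \<lambda>n. measure_pmf.prob (random_hypergraph n (c n) s)
                            {G. clique_output n s k (C n) G = Some (cliques n s G k)}"
  shows "(\<tau> + 2 \<le> k \<and> k \<le> \<kappa> + 1 \<longrightarrow>
            superpoly_small (\<lambda>n. 1 - success n) \<and>
            (\<lambda>n. real (worst_case_runtime n s k (C n)))
              \<in> O(\<lambda>n. real n powr (real \<tau> + 2 - \<alpha> * real ((\<tau> + 1) choose s)))) \<and>
         (k < \<tau> + 2 \<longrightarrow>
            superpoly_small (\<lambda>n. 1 - success n) \<and>
            (\<lambda>n. real (worst_case_runtime n s k (C n)))
              \<in> O(\<lambda>n. real n powr (real k - \<alpha> * real ((k - 1) choose s))))"
proof -
  have s: "0 < s" "s \<le> k" using assms(1,2) by auto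
  have C: "C n = cutoff n (c n) s" for n by (simp add: C_def)
  \<comment> \<open>The upper half of the Theta bound limits the cutoffs and so the runtime; the
    lower half, through \<open>D'\<close>, yields success.\<close>
  obtain D where D: "0 < D" "eventually (\<lambda>n. c n \<le> D * real n powr (- \<alpha>)) sequentially"
    using bigthetaD1[OF c_Theta] c_prob by (elim landau_o.bigE) auto
  obtain D' where D': "0 < D'" "eventually (\<lambda>n. real n powr (- \<alpha>) \<le> D' * c n) sequentially"
    using c_Theta[unfolded bigtheta_sym[of c]] c_prob
    by (elim bigthetaD1[THEN landau_o.bigE]) auto
  have K: "0 < 1 / D'" "eventually (\<lambda>n. 1 / D' * real n powr (- \<alpha>) \<le> c n) sequentially"
    using D'(1) by (auto intro: eventually_mono[OF D'(2)] simp: field_simps)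
  have success: "superpoly_small (\<lambda>n. 1 - success n)" if "k \<le> \<kappa> + 1"
    unfolding success_def C
    by (rule success_probability[OF s c_prob K], rule mult_binomial_less[OF assms(3) s(1) _ _ \<kappa>(1)])
       (use that in auto)
  have runtime: "(\<lambda>n. real (worst_case_runtime n s k (C n))) \<in> O(\<lambda>n. real n powr (g + 1))"
    if "\<And>j. s - 1 \<le> j \<Longrightarrow> j < k \<Longrightarrow> real j - \<alpha> * real (j choose s) \<le> g" for g
    unfolding C by (rule runtime_bigo[OF s _ _ D(2) that]) (use c_prob D(1) in auto)
  \<comment> \<open>As \<open>1 < s\<close>, the case \<open>k < \<tau> + 2\<close> also satisfies
    \<open>k \<le> \<kappa> + 1\<close>, so \<open>success\<close> covers both cases.\<close>
  have \<tau>\<kappa>: "\<tau> \<le> \<kappa>" using \<tau>(1) assms(1) by (intro \<kappa>(2)) auto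
  \<comment> \<open>Here \<open>g\<close> is the global maximum of the exponent, at
    \<open>\<tau> + 1\<close>; the vertex loop adds one more factor \<open>n\<close>.\<close>
  have 1: "(\<lambda>n. real (worst_case_runtime n s k (C n)))
      \<in> O(\<lambda>n. real n powr (real \<tau> + 2 - \<alpha> * real ((\<tau> + 1) choose s)))"
    using runtime[OF growth_exponent_max[OF s(1) assms(3) \<tau>]] by (simp add: algebra_simps)
  have 2: "(\<lambda>n. real (worst_case_runtime n s k (C n)))
      \<in> O(\<lambda>n. real n powr (real k - \<alpha> * real ((k - 1) choose s)))" if "k < \<tau> + 2"
  proof -
    \<comment> \<open>All swept levels lie in the increasing range, so the last one,
      \<open>k - 1\<close>, dominates.\<close>
    have "real j - \<alpha> * real (j choose s) \<le> real (k - 1) - \<alpha> * real ((k - 1) choose s)" if "j < k" for j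
      using that \<open>k < \<tau> + 2\<close> by (intro growth_exponent_mono[OF s(1) assms(3) \<tau>(1)]) auto
    from runtime[OF this] show ?thesis using s by (simp add: of_nat_diff algebra_simps)
  qed
  show ?thesis using success 1 2 \<tau>\<kappa> by auto
qed

end
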